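(* Let $d$ be a negative square-free integer and let $\mathcal{O}_d$ be the ring of integers of $\mathbb{Q}(\sqrt d)$. Then the frieze subring $\mathcal{O}_d^\circ$ equals $\mathcal{O}_d$ if $d\in\{-1,-2,-3,-7,-11\}$, and equals $\mathbb{Z}$ otherwise.
   Context: Let $R$ be a subset of a field. A non-zero frieze pattern of height $n\ge0$ over $R$ is a family $(c_{i,j})$, indexed by $i\in\mathbb{Z}$ and $i\le j\le n+i+3$, with $c_{i,i}=c_{i,n+i+3}=0$, $c_{i,i+1}=c_{i,n+i+2}=1$, $c_{i,j}\in R\setminus\{0\}$ for $i+2\le j\le n+i+1$, and $c_{i,j}c_{i+1,j+1}-c_{i,j+1}c_{i+1,j}=1$ for all $i\in\mathbb{Z}$ and $i+1\le j\le n+i+2$. For a subring $R\le\mathbb{C}$, the frieze subring $R^\circ$ is the subring of $R$ generated by all entries of all non-zero frieze patterns (of all heights) over $R$. *)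

theory Defs
  imports
    Complex_Main
    "HOL-Computational_Algebra.Squarefree"
    "HOL-Computational_Algebra.Polynomial"
    "HOL-Algebra.Generated_Fields"
    "HOL-Decision_Procs.Algebra_Aux"
begin

text \<open>
  The family \<open>(c i j)\<close> is only meant for \<open>i \<le> j \<le> n + i + 3\<close>; the values of the
  total function \<open>c\<close> outside this strip are irrelevant.
\<close>

definition nonzero_frieze :: "nat \<Rightarrow> 'a::field set \<Rightarrow> (int \<Rightarrow> int \<Rightarrow> 'a) \<Rightarrow> bool" where
  "nonzero_frieze n R c \<longleftrightarrow>
     (\<forall>i. c i i = 0 \<and> c i (int n + i + 3) = 0) \<and>
     (\<forall>i. c i (i + 1) = 1 \<and> c i (int n + i + 2) = 1) \<and>
     (\<forall>i j. i + 2 \<le> j \<and> j \<le> int n + i + 1 \<longrightarrow> c i j \<in> R - {0}) \<and>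
     (\<forall>i j. i + 1 \<le> j \<and> j \<le> int n + i + 2 \<longrightarrow>
        c i j * c (i + 1) (j + 1) - c i (j + 1) * c (i + 1) j = 1)"

definition frieze_entries :: "nat \<Rightarrow> (int \<Rightarrow> int \<Rightarrow> 'a) \<Rightarrow> 'a set" where
  "frieze_entries n c = {c i j | i j. i \<le> j \<and> j \<le> int n + i + 3}"

text \<open>
  \<^const>\<open>cring_class_ops\<close> is the type \<^typ>\<open>complex\<close> with its usual operations, viewed as a
  ring with carrier \<^term>\<open>UNIV\<close>. For a subring \<open>R\<close> of the complex numbers, generating inside
  \<open>R\<close> and inside the complex numbers is the same.
\<close>

definition frieze_subring :: "complex set \<Rightarrow> complex set" where
  "frieze_subring R =
     generate_ring cring_class_ops (\<Union>{frieze_entries n c | n c. nonzero_frieze n R c})"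

definition quadratic_field :: "int \<Rightarrow> complex set" where
  "quadratic_field d = generate_field cring_class_ops (insert (csqrt (of_int d)) \<rat>)"

definition quadratic_integers :: "int \<Rightarrow> complex set" where
  "quadratic_integers d = {x \<in> quadratic_field d. algebraic_int x}"

end

theory Submission
  imports Defs
begin

text \<open>
  A non-zero frieze pattern is the family of \<open>2 \<times> 2\<close> minors of a sequence of plane vectors, that is, a
  labelling of the diagonals of a polygon satisfying the Pluecker relations. If all labels of the
  diagonals cutting off a single vertex had norm at least 2, then the labels of the diagonals from
  a fixed vertex would grow strictly in norm and could not return to a boundary label of norm 1. For
  \<open>d \<notin> {-1, -2, -3, -7, -11}\<close> the only non-zero elements of norm less than 2 in the ring of integers
  are \<open>1\<close> and \<open>-1\<close>, so some vertex can be cut off along a diagonal labelled by a sign, and by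
  induction all entries are integers. In the exceptional cases the ring has an
  element \<open>e\<close> generating it that divides 2 or 3, and the quiddity cycle \<open>(e, f, e, f, \<dots>)\<close> with
  \<open>e f = 2\<close> (height 1) or \<open>e f = 3\<close> (height 3) defines a frieze pattern with entry \<open>e\<close>.
\<close>

section \<open>Polygons of vectors and integrality of friezes\<close>

definition wedge :: "'a::comm_ring_1 \<times> 'a \<Rightarrow> 'a \<times> 'a \<Rightarrow> 'a" where
  "wedge v w = fst v * snd w - fst w * snd v"

text \<open>Three vectors in the plane are dependent: \<open>wedge u w\<close> times
  \<open>v\<close> is \<open>wedge u v\<close> times \<open>w\<close> plus \<open>wedge v w\<close>
  times \<open>u\<close>. Taking the wedge of \<open>p\<close> with both sides gives this Ptolemy
  relation.\<close>

lemma wedge_pluecker: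
  "wedge u w * wedge p v = wedge u v * wedge p w + wedge v w * wedge p u"
  by (simp add: wedge_def algebra_simps)

text \<open>Along the fan from \<open>p\<close>, three successive labels of norms x, y, z satisfy 2y
  \<le> z + x, because the sides are signs and the short diagonal has norm at least 2. So x < y
  forces y < z, and an initial increase persists to the end.\<close>

lemma norm_wedge_growth:
  fixes a b p :: "'a::real_normed_field \<times> 'a"
  assumes "successively (\<lambda>v w. wedge v w \<in> {1, -1}) (a # b # ws)"
    and "norm (wedge p a) < norm (wedge p b)"
    and "\<And>xs u v w ys. a # b # ws = xs @ u # v # w # ys \<Longrightarrow> 2 \<le> norm (wedge u w)"
  shows "norm (wedge p b) \<le> norm (wedge p (last (b # ws)))"
  using assms
proof (induction ws arbitrary: a b)
  case Nil
  then show ?case by simp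
next
  case (Cons w ws)
  have units: "norm (wedge a b) = 1" "norm (wedge b w) = 1"
    using Cons.prems(1) by auto
  have "2 \<le> norm (wedge a w)"
    using Cons.prems(3)[of "[]"] by simp
  then have "2 * norm (wedge p b) \<le> norm (wedge a w * wedge p b)"
    by (simp add: norm_mult mult_right_mono)
  also have "\<dots> \<le> norm (wedge p w) + norm (wedge p a)"
    unfolding wedge_pluecker[of a w p b]
    by (rule order_trans[OF norm_triangle_ineq]) (simp add: norm_mult units)
  finally have less: "norm (wedge p b) < norm (wedge p w)"
    using Cons.prems(2) by linarith
  have "norm (wedge p w) \<le> norm (wedge p (last (w # ws)))"
  proof (rule Cons.IH)
    show "successively (\<lambda>v w. wedge v w \<in> {1, -1}) (b # w # ws)"
      using Cons.prems(1) by simp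
    show "2 \<le> norm (wedge u v)" if "b # w # ws = xs @ u # x # v # ys" for xs u x v ys
      using Cons.prems(3)[of "a # xs"] that by simp
  qed (fact less)
  with less show ?case by simp
qed

lemma Ints_unit_cancel:
  fixes x :: "'a::ring_1"
  assumes "e \<in> {1, -1}" "e * x \<in> \<int>"
  shows "x \<in> \<int>"
  using assms by (auto simp: minus_in_Ints_iff)

text \<open>
  The vectors represent the vertices of a polygon, and the wedge of two of them is the label of
  the diagonal between them. By \<open>norm_wedge_growth\<close> some short diagonal has norm
  below 2, hence is a sign; the vertex cut off by it is removed. Signs rather than only \<open>1\<close>
  are allowed on the boundary because that diagonal becomes a boundary edge.
\<close>

lemma wedges_in_Ints:
  fixes vs :: "('a::real_normed_field \<times> 'a) list"
  assumes S: "\<And>s. s \<in> S \<Longrightarrow> norm s < 2 \<Longrightarrow> s \<in> {1, -1}"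
    and "sorted_wrt (\<lambda>v w. wedge v w \<in> S) vs"
    and "successively (\<lambda>v w. wedge v w \<in> {1, -1}) vs"
    and "length vs \<ge> 2 \<Longrightarrow> wedge (hd vs) (last vs) \<in> {1, -1}"
  shows "sorted_wrt (\<lambda>v w. wedge v w \<in> \<int>) vs"
  using assms(2-)
proof (induction "length vs" arbitrary: vs rule: less_induct)
  case less
  show ?case
  proof (cases "length vs \<le> 2")
    case True
    then consider "vs = []" | a where "vs = [a]" | a b where "vs = [a, b]"
      by (cases vs; cases "tl vs"; cases "tl (tl vs)") auto
    then show ?thesis using less.prems(2) by cases auto
  next
    case False
    then obtain p b c rest where vs: "vs = p # b # c # rest"
      by (cases vs; cases "tl vs"; cases "tl (tl vs)") auto
    \<comment> \<open>If every such diagonal had norm at least 2, the fan from \<open>p\<close>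
      would have norm 1 at \<open>b\<close>, at least 2 at \<open>c\<close> and hence at least 2 at
      the last vertex, whereas the closing edge has norm 1. The vertex \<open>v\<close> found here
      is inner to the list, so cutting it off keeps the first and last vertex.\<close>
    have "\<exists>xs u v w ys. vs = xs @ u # v # w # ys \<and> norm (wedge u w) < 2"
    proof (rule ccontr)
      assume "\<nexists>xs u v w ys. vs = xs @ u # v # w # ys \<and> norm (wedge u w) < 2"
      then have none: "2 \<le> norm (wedge u w)" if "vs = xs @ u # v # w # ys" for xs u v w ys
        using that by (metis not_less)
      have "2 \<le> norm (wedge p c)" using none[of "[]" p b c rest] vs by simp
      moreover have "norm (wedge p c) \<le> norm (wedge p (last (c # rest)))"
      proof (rule norm_wedge_growth)
        show "successively (\<lambda>v w. wedge v w \<in> {1, -1}) (b # c # rest)"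
          using less.prems(2) vs by simp
        show "norm (wedge p b) < norm (wedge p c)"
          using \<open>2 \<le> norm (wedge p c)\<close> less.prems(2) vs by auto
        show "2 \<le> norm (wedge u w)" if "b # c # rest = xs @ u # v # w # ys" for xs u v w ys
          using none[of "p # xs" u v w ys] that vs by simp
      qed
      moreover have "norm (wedge p (last (c # rest))) = 1"
        using less.prems(3) vs by auto
      ultimately show False by simp
    qed
    then obtain xs u v w ys where dec: "vs = xs @ u # v # w # ys" and short: "norm (wedge u w) < 2"
      by blast
    have uw: "wedge u w \<in> {1, -1}"
      using less.prems(1) by (intro S[OF _ short]) (simp add: dec sorted_wrt_append)
    have uv: "wedge u v \<in> {1, -1}" and vw: "wedge v w \<in> {1, -1}"
      using less.prems(2) by (simp_all add: dec successively_append_iff)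
    have IH: "sorted_wrt (\<lambda>v w. wedge v w \<in> \<int>) (xs @ u # w # ys)"
    proof (rule less.hyps)
      show "length (xs @ u # w # ys) < length vs" by (simp add: dec)
      show "sorted_wrt (\<lambda>v w. wedge v w \<in> S) (xs @ u # w # ys)"
        using less.prems(1) by (auto simp: dec sorted_wrt_append)
      show "successively (\<lambda>v w. wedge v w \<in> {1, -1}) (xs @ u # w # ys)"
        using less.prems(2) uw by (auto simp: dec successively_append_iff)
      show "wedge (hd (xs @ u # w # ys)) (last (xs @ u # w # ys)) \<in> {1, -1}"
        using less.prems(3) by (cases xs) (auto simp: dec)
    qed
    have ints: "wedge u w \<in> \<int>" "wedge u v \<in> \<int>" "wedge v w \<in> \<int>"
      using uw uv vw by auto
    \<comment> \<open>The labels at the removed vertex are recovered from the smaller polygon by the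
      Pluecker relation, after cancelling the sign \<open>wedge u w\<close>. Vertices before and
      after \<open>v\<close> are separate cases because the arguments of a label follow the order of
      the list.\<close>
    have left: "wedge k v \<in> \<int>" if "k \<in> set xs" for k
    proof -
      have "wedge k u \<in> \<int>" "wedge k w \<in> \<int>" using IH that by (auto simp: sorted_wrt_append)
      then have "wedge u w * wedge k v \<in> \<int>"
        unfolding wedge_pluecker[of u w k v] using ints by auto
      then show ?thesis by (rule Ints_unit_cancel[OF uw])
    qed
    have right: "wedge v k \<in> \<int>" if "k \<in> set ys" for k
    proof -
      have *: "wedge u k \<in> \<int>" "wedge w k \<in> \<int>" using IH that by (auto simp: sorted_wrt_append)
      have "wedge u w * wedge v k = wedge u v * wedge w k + wedge v w * wedge u k"
        by (simp add: wedge_def algebra_simps)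
      also have "\<dots> \<in> \<int>" using * ints by auto
      finally show ?thesis by (rule Ints_unit_cancel[OF uw])
    qed
    show ?thesis
      using IH left right ints unfolding dec by (auto simp: sorted_wrt_append)
  qed
qed

section \<open>From frieze patterns to polygons of vectors\<close>

text \<open>
  The entry \<open>c (i + 1) i\<close> lies outside the strip; the value \<open>- 1\<close> is the one that continues
  the row \<open>c (i + 1)\<close> to the left by the frieze rule.
\<close>

definition frieze_vector :: "(int \<Rightarrow> int \<Rightarrow> 'a::comm_ring_1) \<Rightarrow> int \<Rightarrow> int \<Rightarrow> 'a \<times> 'a" where
  "frieze_vector c i k = (c i k, if k = i then - 1 else c (i + 1) k)"

lemma wedge_frieze_vector_Suc:
  assumes "nonzero_frieze n R c" "i \<le> k" "k \<le> i + int n + 1"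
  shows "wedge (frieze_vector c i k) (frieze_vector c i (k + 1)) = 1"
  using assms unfolding nonzero_frieze_def frieze_vector_def wedge_def by auto

text \<open>The wedges and the entries obey the same unimodular rule, and three corners of an
  adjacent 2 by 2 block determine the fourth when the one to be divided by is nonzero. Induction
  over rows and then over columns therefore identifies them; row \<open>i\<close> agrees because its
  first vector is (0, -1).\<close>

lemma wedge_frieze_vector:
  assumes fr: "nonzero_frieze n R c" and "i \<le> k" "k < l" "l \<le> i + int n + 2"
  shows "wedge (frieze_vector c i k) (frieze_vector c i l) = c k l"
  using assms(2-)
proof (induction k arbitrary: l rule: int_ge_induct)
  case base
  show ?case using fr base by (simp add: nonzero_frieze_def frieze_vector_def wedge_def)
next
  case (step k)
  let ?D = "\<lambda>k l. wedge (frieze_vector c i k) (frieze_vector c i l)"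
  have "k + 2 \<le> l" using step.prems by simp
  then show ?case using step.prems(2)
  proof (induction l rule: int_ge_induct)
    case base
    have "?D (k + 1) (k + 1 + 1) = 1"
      using fr step.hyps base by (intro wedge_frieze_vector_Suc) auto
    moreover have "c (k + 1) (k + 1 + 1) = 1" using fr by (simp only: nonzero_frieze_def)
    ultimately show ?case by (simp add: algebra_simps)
  next
    case (step l)
    note l = step
    have c_rule: "c k l * c (k + 1) (l + 1) - c k (l + 1) * c (k + 1) l = 1"
      using fr l \<open>i \<le> k\<close> unfolding nonzero_frieze_def by simp
    \<comment> \<open>The frieze rule for the wedges is the Pluecker relation for columns
      \<open>k\<close>, \<open>k + 1\<close>, \<open>l\<close>, \<open>l + 1\<close>.\<close>
    have "?D k l * ?D (k + 1) (l + 1) - ?D k (l + 1) * ?D (k + 1) l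
        = ?D k (k + 1) * ?D l (l + 1)"
      by (simp add: wedge_def algebra_simps)
    also have "?D k (k + 1) * ?D l (l + 1) = 1"
      using fr l \<open>i \<le> k\<close> by (simp add: wedge_frieze_vector_Suc)
    finally have "?D k l * ?D (k + 1) (l + 1) - ?D k (l + 1) * ?D (k + 1) l = 1" .
    moreover have "?D k l = c k l" "?D k (l + 1) = c k (l + 1)"
      using l by (auto intro!: \<open>\<And>l. k < l \<Longrightarrow> l \<le> i + int n + 2 \<Longrightarrow> ?D k l = c k l\<close>)
    moreover have "?D (k + 1) l = c (k + 1) l" using l by simp
    ultimately have "c k l * ?D (k + 1) (l + 1) = c k l * c (k + 1) (l + 1)"
      using c_rule by (simp add: algebra_simps)
    \<comment> \<open>Here \<open>k + 2\<close> \<le> \<open>l\<close> \<le>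
      \<open>i + int n + 1\<close>, so the entry is interior to the strip and may be
      cancelled.\<close>
    moreover have "c k l \<noteq> 0"
      using fr l \<open>i \<le> k\<close> unfolding nonzero_frieze_def by simp
    ultimately show ?case by simp
  qed
qed

text \<open>A frieze of height \<open>n\<close> is a labelled polygon with \<open>n + 3\<close>
  vertices. Row \<open>i\<close> is read off from the vectors over the columns \<open>i\<close> to
  \<open>i + n + 2\<close>, whose closing edge is the border entry 1; only the final 0 of the row
  lies beyond them.\<close>

lemma frieze_entries_subset_Ints:
  fixes c :: "int \<Rightarrow> int \<Rightarrow> 'a::real_normed_field"
  assumes fr: "nonzero_frieze n R c"
    and R: "\<And>s. s \<in> R - {0} \<Longrightarrow> norm s < 2 \<Longrightarrow> s \<in> {1, -1}"
  shows "frieze_entries n c \<subseteq> \<int>"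
proof
  fix x assume "x \<in> frieze_entries n c"
  then obtain i j where ij: "x = c i j" "i \<le> j" "j \<le> int n + i + 3"
    unfolding frieze_entries_def by blast
  let ?I = "[i..i + int n + 2]" and ?f = "frieze_vector c i"
  have less: "sorted_wrt (<) ?I" by simp
  have all_ints: "sorted_wrt (\<lambda>v w. wedge v w \<in> \<int>) (map ?f ?I)"
  proof (rule wedges_in_Ints)
    \<comment> \<open>The value 1 is adjoined because the sides of the polygon carry it and
      \<open>R\<close> is an arbitrary set.\<close>
    show "s \<in> {1, -1}" if "s \<in> insert 1 (R - {0})" "norm s < 2" for s
      using that R by blast
    show "sorted_wrt (\<lambda>v w. wedge v w \<in> insert 1 (R - {0})) (map ?f ?I)"
      unfolding sorted_wrt_map
    proof (rule sorted_wrt_mono_rel[OF _ less])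
      fix k l assume kl: "k \<in> set ?I" "l \<in> set ?I" "k < l"
      then have "wedge (?f k) (?f l) = c k l"
        by (intro wedge_frieze_vector[OF fr]) auto
      moreover have "c k l \<in> insert 1 (R - {0})"
      proof -
        consider "l = k + 1" | "l = int n + k + 2" | "k + 2 \<le> l" "l \<le> int n + k + 1"
          using kl by force
        then show ?thesis using fr unfolding nonzero_frieze_def by cases auto
      qed
      ultimately show "wedge (?f k) (?f l) \<in> insert 1 (R - {0})" by simp
    qed
    have "wedge (?f (?I ! m)) (?f (?I ! Suc m)) = 1" if "Suc m < length ?I" for m
      using that wedge_frieze_vector_Suc[OF fr, of i "i + int m"] by (simp add: ac_simps)
    then show "successively (\<lambda>v w. wedge v w \<in> {1, -1}) (map ?f ?I)"
      unfolding successively_map successively_conv_nth by simp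
    have "wedge (?f i) (?f (i + int n + 2)) = c i (int n + i + 2)"
      using wedge_frieze_vector[OF fr, of i i "i + int n + 2"] by (simp add: ac_simps)
    then have "wedge (?f i) (?f (i + int n + 2)) = 1"
      using fr unfolding nonzero_frieze_def by simp
    moreover have "hd ?I = i" by (simp add: upto_rec1)
    moreover have "last ?I = i + int n + 2" by (simp add: upto_rec2[of i "i + int n + 2"])
    ultimately show "wedge (hd (map ?f ?I)) (last (map ?f ?I)) \<in> {1, -1}"
      by (simp add: hd_map last_map)
  qed
  consider "j = i" | "j = int n + i + 3" | "i < j" "j \<le> i + int n + 2"
    using ij by force
  then show "x \<in> \<int>"
  proof cases
    case 3
    then have "wedge (?f i) (?f j) \<in> \<int>"
      using all_ints by (simp add: upto_rec1[of i])
    then show ?thesis using ij 3 wedge_frieze_vector[OF fr, of i i j] by simp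
  qed (use fr ij in \<open>auto simp: nonzero_frieze_def\<close>)
qed

section \<open>Integers of imaginary quadratic fields\<close>

text \<open>
  Pseudo-division of a monic annihilating polynomial by the primitive quadratic one is exact, and
  comparing contents shows that the leading coefficient of the latter is a unit.
\<close>

lemma quadratic_relation_of_algebraic_int:
  fixes x :: complex
  assumes "algebraic_int x" and nonreal: "Im x \<noteq> 0"
    and "t \<in> \<rat>" "m \<in> \<rat>" and rel: "x\<^sup>2 - t * x + m = 0"
  shows "t \<in> \<int> \<and> m \<in> \<int>"
proof -
  define ev :: "int poly \<Rightarrow> complex" where "ev p = poly (map_poly of_int p) x" for p
  have ev_0: "ev 0 = 0" and ev_pCons: "ev (pCons k p) = of_int k + x * ev p" for k p
    by (simp_all add: ev_def map_poly_pCons)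
  have ev_add: "ev (p + q) = ev p + ev q" for p q
    by (induction p q rule: poly_induct2) (simp_all add: ev_0 ev_pCons algebra_simps)
  have ev_smult: "ev (Polynomial.smult k p) = of_int k * ev p" for k p
    by (induction p) (simp_all add: ev_0 ev_pCons algebra_simps)
  have ev_mult: "ev (p * q) = ev p * ev q" for p q
    by (induction p) (simp_all add: ev_0 ev_pCons ev_add ev_smult algebra_simps)
  obtain P where P: "ev P = 0" "lead_coeff P = 1"
    using assms(1) unfolding algebraic_int_altdef_ipoly ev_def by blast
  have indep: "u = 0 \<and> v = 0" if "u \<in> \<real>" "v \<in> \<real>" "u * x + v = 0" for u v
    using that nonreal by (auto simp: complex_eq_iff complex_is_Real_iff)

  obtain a b where t: "t = of_int a / of_int b" "b > 0"
    using \<open>t \<in> \<rat>\<close> by (rule Rats_cases')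
  obtain a' b' where m: "m = of_int a' / of_int b'" "b' > 0"
    using \<open>m \<in> \<rat>\<close> by (rule Rats_cases')
  \<comment> \<open>The relation with denominators cleared: \<open>b * b'\<close> times X^2 - t X +
    m.\<close>
  define Q0 where "Q0 = [:a' * b, - a * b', b * b':]"
  have "ev Q0 = of_int (b * b') * (x\<^sup>2 - t * x + m)"
  proof -
    have "of_int a = t * of_int b" "of_int a' = m * of_int b'" using t m by simp_all
    then show ?thesis by (simp add: Q0_def ev_pCons ev_0 power2_eq_square algebra_simps)
  qed
  then have Q0: "ev Q0 = 0" "Q0 \<noteq> 0" "degree Q0 = 2"
    using t m rel by (simp_all add: Q0_def)
  define Q where "Q = primitive_part Q0"
  have Q: "ev Q = 0" "content Q = 1" "degree Q = 2" "Q \<noteq> 0"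
    using Q0 ev_smult[of "content Q0" Q] by (auto simp: Q_def)

  let ?r = "pseudo_mod P Q"
  obtain k q where k: "k \<noteq> 0" "Polynomial.smult k P = Q * q + ?r"
    using pseudo_mod(1)[OF \<open>Q \<noteq> 0\<close>] by blast
  have "degree ?r < 2" using pseudo_mod(2)[OF \<open>Q \<noteq> 0\<close>, of P] Q by auto
  obtain r0 r1 where r: "?r = [:r0, r1:]"
  proof -
    obtain r0 r' where r': "?r = pCons r0 r'" by (cases ?r)
    then have "degree r' = 0" using \<open>degree ?r < 2\<close> by (auto split: if_splits)
    then show ?thesis using that r' by (metis degree_eq_zeroE)
  qed
  \<comment> \<open>The remainder is linear and vanishes at \<open>x\<close>; as \<open>x\<close> is
    nonreal, 1 and \<open>x\<close> are independent over the reals, so the remainder is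
    zero.\<close>
  have "ev ?r = 0"
    using arg_cong[OF k(2), of ev] P Q by (simp add: ev_mult ev_add ev_smult)
  then have "of_int r1 * x + of_int r0 = 0" by (simp add: r ev_pCons ev_0 algebra_simps)
  then have "?r = 0" using indep[of "of_int r1" "of_int r0"] by (simp add: r)
  then have kP: "Polynomial.smult k P = Q * q" using k by simp
  \<comment> \<open>Gauss's lemma: \<open>P\<close> and \<open>Q\<close> have content 1, so
    \<open>q\<close> has content \<bar>k\<bar> and \<open>k\<close> divides its leading coefficient.
    Comparison with the leading coefficient \<open>k\<close> of the product leaves a unit for that
    of \<open>Q\<close>.\<close>
  have "is_unit (content P)" using content_dvd_coeff[of P "degree P"] P(2) by argo
  then have "content P = 1" by (rule is_unit_content_iff[THEN iffD1])
  then have "content q = \<bar>k\<bar>"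
    using arg_cong[OF kP, of content] Q by (simp add: content_mult)
  then have "k dvd lead_coeff q" using content_dvd_coeff[of q "degree q"] by simp
  then obtain e where "lead_coeff q = k * e" by (rule dvdE)
  moreover have "k = lead_coeff Q * lead_coeff q"
    using arg_cong[OF kP, of lead_coeff] P(2) k(1) by (simp add: lead_coeff_mult)
  ultimately have "lead_coeff Q * e = 1" using k(1) by simp
  then have unit: "lead_coeff Q \<in> {1, -1}" by (auto simp: zmult_eq_1_iff)

  define \<epsilon> where "\<epsilon> = lead_coeff Q"
  obtain c0 c1 where "Q = [:c0, c1, \<epsilon>:]"
  proof -
    obtain c0 Q' where Q': "Q = pCons c0 Q'" by (cases Q)
    obtain c1 Q'' where Q'': "Q' = pCons c1 Q''" by (cases Q')
    have "degree Q'' = 0" using Q(3) Q' Q'' by (auto split: if_splits)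
    then obtain c2 where "Q'' = [:c2:]" by (metis degree_eq_zeroE)
    then show ?thesis using that Q' Q'' Q(3) by (auto simp: \<epsilon>_def numeral_2_eq_2 split: if_splits)
  qed
  then have "of_int c0 + x * (of_int c1 + x * of_int \<epsilon>) = 0"
    using Q(1) by (simp add: ev_pCons ev_0)
  then have "of_int \<epsilon> * (of_int c0 + x * (of_int c1 + x * of_int \<epsilon>)) = 0" by simp
  then have rel': "x\<^sup>2 + of_int (\<epsilon> * c1) * x + of_int (\<epsilon> * c0) = 0"
    using unit unfolding \<epsilon>_def[symmetric] by (auto simp: algebra_simps power2_eq_square)
  \<comment> \<open>The difference of two monic quadratic relations for \<open>x\<close> is linear
    with real coefficients, so it vanishes identically and \<open>t\<close>, \<open>m\<close> are
    the integer coefficients up to sign.\<close>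
  have "(t + of_int (\<epsilon> * c1)) * x + (of_int (\<epsilon> * c0) - m)
      = (x\<^sup>2 + of_int (\<epsilon> * c1) * x + of_int (\<epsilon> * c0)) - (x\<^sup>2 - t * x + m)"
    by (simp add: algebra_simps)
  also have "\<dots> = 0" unfolding rel rel' by simp
  finally have "(t + of_int (\<epsilon> * c1)) * x + (of_int (\<epsilon> * c0) - m) = 0" .
  moreover have "t + of_int (\<epsilon> * c1) \<in> \<real>" "of_int (\<epsilon> * c0) - m \<in> \<real>"
    using t m by auto
  ultimately have "t + of_int (\<epsilon> * c1) = 0" "of_int (\<epsilon> * c0) - m = 0"
    using indep by blast+
  then have "t = - of_int (\<epsilon> * c1)" "m = of_int (\<epsilon> * c0)"
    by (simp_all only: add_eq_0_iff2 right_minus_eq)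
  then show ?thesis by (metis Ints_minus Ints_of_int)
qed

section \<open>Coordinates in quadratic fields and their rings of integers\<close>

lemma m_inv_cring_class_ops: "x \<noteq> 0 \<Longrightarrow> inv\<^bsub>cring_class_ops\<^esub> x = inverse (x :: 'a::field)"
  by (rule cring_class.comm_inv_char) (simp_all add: carrier_class)

lemma quadratic_field_iff:
  "x \<in> quadratic_field d \<longleftrightarrow> (\<exists>p\<in>\<rat>. \<exists>q\<in>\<rat>. x = p + q * csqrt (of_int d))" (is "_ \<longleftrightarrow> ?P x")
proof
  let ?r = "csqrt (of_int d)"
  have r: "?r * ?r = of_int d" by (metis power2_csqrt power2_eq_square)
  assume "x \<in> quadratic_field d"
  then show "?P x"
    unfolding quadratic_field_def
  proof (induction rule: generate_field.induct)
    case one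
    then show ?case unfolding one_class by (intro bexI[of _ 1] bexI[of _ 0]) auto
  next
    case (incl h)
    then show ?case
    proof
      assume "h = ?r"
      then show ?thesis by (intro bexI[of _ 1] bexI[of _ 0]) auto
    next
      assume "h \<in> \<rat>"
      then show ?thesis by (intro bexI[of _ 0] bexI[of _ h]) auto
    qed
  next
    case (a_inv h)
    then obtain p q where "p \<in> \<rat>" "q \<in> \<rat>" "h = p + q * ?r" by blast
    then show ?case unfolding uminus_class
      by (intro bexI[of _ "-p"] bexI[of _ "-q"]) auto
  next
    case (m_inv h)
    then obtain p q where h: "p \<in> \<rat>" "q \<in> \<rat>" "h = p + q * ?r" by blast
    have inv: "inv\<^bsub>cring_class_ops\<^esub> h = inverse h"
      using m_inv by (intro m_inv_cring_class_ops) (simp add: zero_class)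
    \<comment> \<open>The norm of \<open>h\<close>: inverses are obtained by multiplying with the
      conjugate.\<close>
    define N where "N = p\<^sup>2 - of_int d * q\<^sup>2"
    have "h * (p - q * ?r) = p\<^sup>2 - (?r * ?r) * q\<^sup>2"
      unfolding h(3) by (simp add: power2_eq_square algebra_simps)
    then have N: "h * (p - q * ?r) = N" unfolding r N_def .
    show ?case
    proof (cases "N = 0")
      case False
      have "inverse h = (p - q * ?r) / N"
        using N False m_inv by (simp add: divide_eq_eq eq_divide_eq inverse_eq_divide zero_class mult.commute)
      then have "inverse h = p / N + (- q / N) * ?r"
        by (simp add: diff_divide_distrib)
      moreover have "N \<in> \<rat>" using h by (simp add: N_def)
      ultimately show ?thesis unfolding inv using h
        by (intro bexI[of _ "p / N"] bexI[of _ "- q / N"]) simp_all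
    next
      \<comment> \<open>Since \<open>d\<close> is arbitrary here, its root may be rational, and then
        the conjugate of a nonzero \<open>h\<close> can vanish. In that case \<open>h\<close> itself
        is rational.\<close>
      case True
      then have "p = q * ?r" using N m_inv by (simp add: zero_class)
      then have "h = p + p" using h by simp
      then have "inverse h = inverse (p + p) + 0 * ?r" by simp
      moreover have "inverse (p + p) \<in> \<rat>" using h by simp
      ultimately show ?thesis unfolding inv
        by (intro bexI[of _ "inverse (p + p)"] bexI[of _ 0]) simp_all
    qed
  next
    case (eng_add h1 h2)
    then obtain p q p' q' where "p \<in> \<rat>" "q \<in> \<rat>" "h1 = p + q * ?r" "p' \<in> \<rat>" "q' \<in> \<rat>" "h2 = p' + q' * ?r"
      by blast
    then show ?case unfolding plus_class
      by (intro bexI[of _ "p + p'"] bexI[of _ "q + q'"]) (auto simp: algebra_simps)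
  next
    case (eng_mult h1 h2)
    then obtain p q p' q' where "p \<in> \<rat>" "q \<in> \<rat>" "h1 = p + q * ?r" "p' \<in> \<rat>" "q' \<in> \<rat>" "h2 = p' + q' * ?r"
      by blast
    moreover from this have "h1 * h2 = (p * p' + q * q' * (?r * ?r)) + (p * q' + q * p') * ?r"
      by (simp add: algebra_simps)
    then have "h1 * h2 = (p * p' + q * q' * of_int d) + (p * q' + q * p') * ?r"
      unfolding r .
    ultimately show ?case unfolding times_class
      by (intro bexI[of _ "p * p' + q * q' * of_int d"] bexI[of _ "p * q' + q * p'"]) auto
  qed
next
  let ?F = "generate_field cring_class_ops (insert (csqrt (of_int d)) \<rat>)"
  assume "?P x"
  then obtain p q where x: "p \<in> \<rat>" "q \<in> \<rat>" "x = p + q * csqrt (of_int d)" by blast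
  have "p \<in> ?F" "q \<in> ?F" "csqrt (of_int d) \<in> ?F"
    using x by (auto intro: generate_field.incl)
  then have "p + q * csqrt (of_int d) \<in> ?F"
    using generate_field.eng_add[of _ cring_class_ops] generate_field.eng_mult[of _ cring_class_ops]
    unfolding plus_class times_class by blast
  then show "x \<in> quadratic_field d" unfolding quadratic_field_def x(3) .
qed

lemma csqrt_of_neg_int:
  assumes "d < 0"
  shows "csqrt (of_int d) = \<i> * of_real (sqrt (of_int (- d)))"
  using assms by (subst csqrt_of_real_nonpos) auto

text \<open>With q = a/b in lowest terms, b^2 is coprime to a^2 and hence divides \<open>d\<close>,
  so b is a unit.\<close>

lemma int_of_squarefree_mult_square:
  fixes q :: "'a::field_char_0"
  assumes "squarefree (d::int)" "q \<in> \<rat>" "of_int d * q\<^sup>2 \<in> \<int>"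
  shows "q \<in> \<int>"
proof -
  obtain a b where q: "b > 0" "coprime a b" "q = of_int a / of_int b"
    using \<open>q \<in> \<rat>\<close> by (rule Rats_cases')
  obtain N where "of_int d * q\<^sup>2 = of_int N" using assms(3) by (auto elim: Ints_cases)
  then have "of_int (d * a\<^sup>2) = (of_int (N * b\<^sup>2) :: 'a)"
    using q by (simp add: field_simps)
  then have "d * a\<^sup>2 = N * b\<^sup>2" by (simp only: of_int_eq_iff)
  then have "b\<^sup>2 dvd d * a\<^sup>2" by simp
  moreover have "coprime (b\<^sup>2) (a\<^sup>2)" using q by (simp add: coprime_commute)
  ultimately have "b\<^sup>2 dvd d" by (simp add: coprime_dvd_mult_left_iff)
  then have "b dvd 1" using assms(1) by (simp add: squarefree_def)
  then show ?thesis using q by auto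
qed

text \<open>Here \<open>t\<close> is the trace of \<open>x\<close>, and a quarter of t^2 - d s^2 is
  its norm; integrality of \<open>x\<close> amounts to integrality of these two. Half-integral
  coordinates treat all residues of \<open>d\<close> modulo 4 at once.\<close>

lemma quadratic_integers_iff:
  assumes d: "d < 0" "squarefree d"
  shows "x \<in> quadratic_integers d \<longleftrightarrow>
    (\<exists>t s :: int. 4 dvd t\<^sup>2 - d * s\<^sup>2 \<and> x = (of_int t + of_int s * csqrt (of_int d)) / 2)"
    (is "_ \<longleftrightarrow> ?P")
proof
  let ?r = "csqrt (of_int d)"
  have r: "?r\<^sup>2 = of_int d" by simp
  have Im_r: "Im ?r \<noteq> 0" and Re_r: "Re ?r = 0"
    using d by (simp_all add: csqrt_of_neg_int del: csqrt.simps)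
  {
    assume "x \<in> quadratic_integers d"
    then obtain p q where pq: "p \<in> \<rat>" "q \<in> \<rat>" "x = p + q * ?r" and int: "algebraic_int x"
      by (auto simp: quadratic_integers_def quadratic_field_iff)
    show ?P
    \<comment> \<open>The rational case is separate because comparing quadratic relations requires a
      nonreal \<open>x\<close>.\<close>
    proof (cases "q = 0")
      case True
      then have "x \<in> \<int>" using pq int by (auto intro: rational_algebraic_int_is_int)
      then obtain k where "x = of_int k" by (auto elim: Ints_cases)
      then show ?thesis by (intro exI[of _ "2 * k"] exI[of _ 0]) auto
    next
      case False
      have "Im x \<noteq> 0"
      proof -
        have "p \<in> \<real>" "q \<in> \<real>" using pq by (auto elim!: Rats_cases')
        then show ?thesis
          using pq(3) False Im_r Re_r by (auto simp: complex_is_Real_iff complex_eq_iff simp del: csqrt.simps)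
      qed
      moreover have "x\<^sup>2 - (2 * p) * x + (p\<^sup>2 - ?r\<^sup>2 * q\<^sup>2) = 0"
        unfolding pq(3) by (simp add: power2_eq_square algebra_simps)
      then have "x\<^sup>2 - (2 * p) * x + (p\<^sup>2 - of_int d * q\<^sup>2) = 0" unfolding r .
      ultimately have ints: "2 * p \<in> \<int>" "p\<^sup>2 - of_int d * q\<^sup>2 \<in> \<int>"
        using quadratic_relation_of_algebraic_int[OF int, of "2 * p" "p\<^sup>2 - of_int d * q\<^sup>2"] pq
        by auto
      \<comment> \<open>Trace and norm give the integrality of d (2q)^2, from which squarefreeness
        extracts that of 2q.\<close>
      have "of_int d * (2 * q)\<^sup>2 = (2 * p)\<^sup>2 - 4 * (p\<^sup>2 - of_int d * q\<^sup>2)"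
        by (simp add: power_mult_distrib algebra_simps)
      also have "\<dots> \<in> \<int>" by (rule Ints_diff[OF Ints_power[OF ints(1)] Ints_mult[OF Ints_numeral ints(2)]])
      finally have "of_int d * (2 * q)\<^sup>2 \<in> \<int>" .
      then have "2 * q \<in> \<int>" using int_of_squarefree_mult_square[OF d(2), of "2 * q"] pq by simp
      then obtain t s n where ts: "2 * p = of_int t" "2 * q = of_int s" "p\<^sup>2 - of_int d * q\<^sup>2 = of_int n"
        using ints by (metis Ints_cases)
      have "(2 * p)\<^sup>2 - of_int d * (2 * q)\<^sup>2 = 4 * (p\<^sup>2 - of_int d * q\<^sup>2)"
        by (simp add: power_mult_distrib algebra_simps)
      then have "of_int (t\<^sup>2 - d * s\<^sup>2) = (of_int (4 * n) :: complex)" by (simp add: ts)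
      then have "t\<^sup>2 - d * s\<^sup>2 = 4 * n" by (simp only: of_int_eq_iff)
      moreover have "x = (of_int t + of_int s * ?r) / 2"
        unfolding ts[symmetric] pq(3) by (simp add: field_simps)
      ultimately show ?thesis
        by (intro exI[of _ t] exI[of _ s]) simp
    qed
  }
  {
    assume ?P
    then obtain t s n where x: "t\<^sup>2 - d * s\<^sup>2 = 4 * n" "x = (of_int t + of_int s * ?r) / 2"
      by (auto elim: dvdE)
    have n: "of_int n = (of_int t ^ 2 - of_int d * of_int s ^ 2) / (4 :: complex)"
      using arg_cong[OF x(1), of "of_int :: int \<Rightarrow> complex"] by simp
    have "x \<in> quadratic_field d"
      unfolding quadratic_field_iff x(2)
      by (intro bexI[of _ "of_int t / 2"] bexI[of _ "of_int s / 2"]) (auto simp: field_simps)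
    moreover have "algebraic_int x"
    proof (rule algebraic_int.intros)
      show "poly [:of_int n, - of_int t, 1:] x = 0"
      proof -
        have "poly [:of_int n, - of_int t, 1:] x = x\<^sup>2 - of_int t * x + of_int n"
          by (simp add: power2_eq_square algebra_simps)
        also have "\<dots> = (?r\<^sup>2 - of_int d) * of_int s ^ 2 / 4"
          unfolding x(2) n by (simp add: field_simps power2_eq_square)
        also have "\<dots> = 0" by simp
        finally show ?thesis .
      qed
      show "\<forall>i. poly.coeff [:of_int n, - of_int t, 1:] i \<in> (\<int> :: complex set)"
        by (auto simp: coeff_pCons split: nat.splits)
    qed simp
    ultimately show "x \<in> quadratic_integers d" by (simp add: quadratic_integers_def)
  }
qed

text \<open>Four times the squared norm is t^2 - d s^2, a multiple of 4 strictly between 0 and 16.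
  For nonzero \<open>s\<close> this bounds -d by 12; squarefreeness and the excluded values leave
  -5, -6 and -10, which a finite check rules out.\<close>

lemma quadratic_integers_norm_less_2:
  assumes d: "d < 0" "squarefree d" "d \<notin> {-1, -2, -3, -7, -11}"
    and x: "x \<in> quadratic_integers d" "x \<noteq> 0" "norm x < 2"
  shows "x \<in> {1, -1}"
proof -
  let ?r = "csqrt (of_int d)"
  obtain t s where ts: "4 dvd t\<^sup>2 - d * s\<^sup>2" "x = (of_int t + of_int s * ?r) / 2"
    using x d quadratic_integers_iff by blast
  have "(norm x)\<^sup>2 = ((of_int t)\<^sup>2 - of_int d * (of_int s)\<^sup>2) / 4"
    using d unfolding ts(2)
    by (simp add: cmod_power2 csqrt_of_neg_int power_divide power_mult_distrib field_simps del: csqrt.simps)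
  then have norm: "4 * (norm x)\<^sup>2 = of_int (t\<^sup>2 - d * s\<^sup>2)" by simp
  have "(norm x)\<^sup>2 < 2\<^sup>2" using x by (intro power_strict_mono) auto
  then have "real_of_int (t\<^sup>2 - d * s\<^sup>2) < of_int 16" unfolding norm[symmetric] by simp
  then have "t\<^sup>2 - d * s\<^sup>2 < 16" by (simp only: of_int_less_iff)
  moreover have "0 < (norm x)\<^sup>2" using x by simp
  then have "real_of_int (t\<^sup>2 - d * s\<^sup>2) > of_int 0" unfolding norm[symmetric] by simp
  then have "0 < t\<^sup>2 - d * s\<^sup>2" by (simp only: of_int_less_iff)
  ultimately have cases: "t\<^sup>2 - d * s\<^sup>2 \<in> {4, 8, 12}"
    using ts(1) by (auto elim!: dvdE)
  have small: "k \<in> {-3, -2, -1, 0, 1, 2, 3}" if "k\<^sup>2 < 4\<^sup>2" for k :: int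
  proof -
    have "\<bar>k\<bar> < 4" using power2_less_imp_less[of "\<bar>k\<bar>" 4] that by simp
    then show ?thesis unfolding insert_iff by arith
  qed
  have "d * s\<^sup>2 \<le> 0" using d by (simp add: mult_nonpos_nonneg)
  then have t: "t \<in> {-3, -2, -1, 0, 1, 2, 3}" using cases by (intro small) auto
  have "s = 0"
  proof (rule ccontr)
    assume "s \<noteq> 0"
    then have s: "1 \<le> s\<^sup>2" by (simp add: int_one_le_iff_zero_less)
    have no_square: "\<not> 2\<^sup>2 dvd d" "\<not> 3\<^sup>2 dvd d"
      using d(2)[unfolded squarefree_def, rule_format, of 2]
        d(2)[unfolded squarefree_def, rule_format, of 3] by auto
    have "s\<^sup>2 \<le> (- d) * s\<^sup>2" using d mult_right_mono[of 1 "- d" "s\<^sup>2"] by simp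
    moreover have "- d \<le> (- d) * s\<^sup>2" using d s mult_left_mono[of 1 "s\<^sup>2" "- d"] by simp
    moreover have "t\<^sup>2 - d * s\<^sup>2 \<le> 12" using cases by auto
    then have "(- d) * s\<^sup>2 \<le> 12" using zero_le_power2[of t] by linarith
    ultimately have "- d \<le> 12" "s\<^sup>2 < 4\<^sup>2" by simp_all
    have "d \<in> {-12, -10, -9, -8, -6, -5, -4}"
      using d(1,3) \<open>- d \<le> 12\<close> unfolding insert_iff empty_iff by presburger
    then have "d \<in> {-10, -6, -5}" using no_square by auto
    moreover have "s \<in> {-3, -2, -1, 0, 1, 2, 3}" using \<open>s\<^sup>2 < 4\<^sup>2\<close> by (rule small)
    ultimately show False using cases t \<open>s \<noteq> 0\<close> by auto
  qed
  then have "t \<in> {2, -2}" using cases t by auto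
  then show ?thesis using ts(2) \<open>s = 0\<close> by auto
qed

section \<open>Frieze subrings\<close>

lemma entry_in_frieze_subring:
  "nonzero_frieze n R c \<Longrightarrow> i \<le> j \<Longrightarrow> j \<le> int n + i + 3 \<Longrightarrow> c i j \<in> frieze_subring R"
  unfolding frieze_subring_def frieze_entries_def by (intro generate_ring.incl) blast

section \<open>Explicit friezes on the quadrilateral and the hexagon\<close>

text \<open>A quadrilateral with unit sides and diagonals \<open>e\<close>, \<open>f\<close>:
  Ptolemy's relation reads e f = 1 + 1.\<close>

lemma nonzero_frieze_height_1:
  fixes e f :: "'a::field"
  assumes "e * f = 2" "e \<in> R - {0}" "f \<in> R - {0}"
  shows "nonzero_frieze 1 R (\<lambda>i j. if j - i \<in> {0, 4} then 0
    else if j - i = 2 then (if even i then e else f) else 1)"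
  unfolding nonzero_frieze_def
proof (intro conjI allI impI; (elim conjE)?)
  fix i j :: int
  assume "i + 1 \<le> j" "j \<le> int 1 + i + 2"
  then consider "j = i + 1" | "j = i + 2" | "j = i + 3" by force
  then show "(if j - i \<in> {0, 4} then 0 else if j - i = 2 then if even i then e else f else 1) *
      (if j + 1 - (i + 1) \<in> {0, 4} then 0
       else if j + 1 - (i + 1) = 2 then if even (i + 1) then e else f else 1) -
      (if j + 1 - i \<in> {0, 4} then 0 else if j + 1 - i = 2 then if even i then e else f else 1) *
      (if j - (i + 1) \<in> {0, 4} then 0
       else if j - (i + 1) = 2 then if even (i + 1) then e else f else 1) = 1"
    using assms by cases (auto simp: mult.commute)
qed (use assms in auto)

text \<open>A hexagon with unit sides, short diagonals alternately \<open>e\<close> and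
  \<open>f\<close>, and long diagonals 2. The frieze rule reduces to e f - 2 = 1 and 2 * 2 - e f =
  1.\<close>

lemma nonzero_frieze_height_3:
  fixes e f :: "'a::field_char_0"
  assumes "e * f = 3" "e \<in> R - {0}" "f \<in> R - {0}" "2 \<in> R"
  shows "nonzero_frieze 3 R (\<lambda>i j. if j - i \<in> {0, 6} then 0
    else if j - i = 3 then 2 else if j - i \<in> {2, 4} then (if even i then e else f) else 1)"
  unfolding nonzero_frieze_def
proof (intro conjI allI impI; (elim conjE)?)
  fix i j :: int
  assume "i + 1 \<le> j" "j \<le> int 3 + i + 2"
  then consider "j = i + 1" | "j = i + 2" | "j = i + 3" | "j = i + 4" | "j = i + 5" by force
  then show "(if j - i \<in> {0, 6} then 0
       else if j - i = 3 then 2 else if j - i \<in> {2, 4} then if even i then e else f else 1) *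
      (if j + 1 - (i + 1) \<in> {0, 6} then 0
       else if j + 1 - (i + 1) = 3 then 2
       else if j + 1 - (i + 1) \<in> {2, 4} then if even (i + 1) then e else f else 1) -
      (if j + 1 - i \<in> {0, 6} then 0
       else if j + 1 - i = 3 then 2 else if j + 1 - i \<in> {2, 4} then if even i then e else f else 1) *
      (if j - (i + 1) \<in> {0, 6} then 0
       else if j - (i + 1) = 3 then 2
       else if j - (i + 1) \<in> {2, 4} then if even (i + 1) then e else f else 1) = 1"
    using assms by cases (auto simp: mult.commute)
qed (use assms in auto)

lemma factor_in_frieze_subring:
  assumes "e * f \<in> {2, 3}" "e \<in> R" "f \<in> R" "2 \<in> R"
  shows "e \<in> frieze_subring R"
proof -
  have nz: "e \<in> R - {0}" "f \<in> R - {0}" using assms by auto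
  from assms(1) consider "e * f = 2" | "e * f = 3" by blast
  then show ?thesis
  proof cases
    case 1
    show ?thesis using entry_in_frieze_subring[OF nonzero_frieze_height_1[OF 1 nz], of 0 2] by simp
  next
    case 2
    show ?thesis using entry_in_frieze_subring[OF nonzero_frieze_height_3[OF 2 nz assms(4)], of 0 2] by simp
  qed
qed

section \<open>Ring structure and monogenic rings\<close>

lemma frieze_subring_ring_closed:
  shows "x \<in> frieze_subring R \<Longrightarrow> y \<in> frieze_subring R \<Longrightarrow> x + y \<in> frieze_subring R"
    and "x \<in> frieze_subring R \<Longrightarrow> y \<in> frieze_subring R \<Longrightarrow> x * y \<in> frieze_subring R"
    and "x \<in> frieze_subring R \<Longrightarrow> - x \<in> frieze_subring R"
    and "1 \<in> frieze_subring R"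
  unfolding frieze_subring_def
  using generate_ring.eng_add[of x cring_class_ops _ y] generate_ring.eng_mult[of x cring_class_ops _ y]
    generate_ring.a_inv[of x cring_class_ops] generate_ring.one[of cring_class_ops]
  by (simp_all add: plus_class times_class uminus_class one_class)

lemma of_int_in_frieze_subring: "of_int k \<in> frieze_subring R"
proof (induction k rule: int_induct[of _ 0])
  case base
  show ?case using frieze_subring_ring_closed(1)[of 1 R "- 1"] frieze_subring_ring_closed(3,4) by force
next
  case (step1 k)
  then show ?case using frieze_subring_ring_closed(1,4) by force
next
  case (step2 k)
  then show ?case using frieze_subring_ring_closed(1)[of "of_int k" R "- 1"] frieze_subring_ring_closed(3,4) by force
qed

lemma frieze_subring_subsetI:
  assumes "\<And>n c. nonzero_frieze n R c \<Longrightarrow> frieze_entries n c \<subseteq> S"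
    and "\<And>x y. x \<in> S \<Longrightarrow> y \<in> S \<Longrightarrow> x + y \<in> S"
    and "\<And>x y. x \<in> S \<Longrightarrow> y \<in> S \<Longrightarrow> x * y \<in> S"
    and "\<And>x. x \<in> S \<Longrightarrow> - x \<in> S" and "1 \<in> S"
  shows "frieze_subring R \<subseteq> S"
proof
  fix x assume "x \<in> frieze_subring R"
  then show "x \<in> S"
    unfolding frieze_subring_def
  proof (induction rule: generate_ring.induct)
    case (incl h)
    then show ?case using assms(1) by blast
  qed (use assms(2-) in \<open>auto simp: plus_class times_class uminus_class one_class\<close>)
qed

lemma frieze_entries_subset:
  assumes "nonzero_frieze n R c"
  shows "frieze_entries n c \<subseteq> insert 0 (insert 1 R)"
proof
  fix x assume "x \<in> frieze_entries n c"
  then obtain i j where ij: "x = c i j" "i \<le> j" "j \<le> int n + i + 3"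
    unfolding frieze_entries_def by blast
  then consider "j = i" | "j = i + 1" | "j = int n + i + 2" | "j = int n + i + 3"
    | "i + 2 \<le> j" "j \<le> int n + i + 1" by force
  then show "x \<in> insert 0 (insert 1 R)"
    using assms ij(1) unfolding nonzero_frieze_def by cases auto
qed

text \<open>\<open>k + \<omega>\<close> generates the ring over the integers just as
  \<open>\<omega>\<close> does, so one frieze having it as an entry suffices. The shift
  \<open>k\<close> leaves room to choose a generator dividing 2 or 3.\<close>

lemma frieze_subring_monogenic:
  fixes \<omega> :: complex and P Q k :: int
  defines "R \<equiv> {of_int a + of_int b * \<omega> |a b. True}"
  assumes \<omega>: "\<omega>\<^sup>2 = of_int P * \<omega> - of_int Q"
    and e: "(of_int k + \<omega>) * f \<in> {2, 3}" "f \<in> R"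
  shows "frieze_subring R = R"
proof (rule subset_antisym)
  have R_of_int: "of_int a \<in> R" for a
    unfolding R_def by (rule CollectI, rule exI[of _ a], rule exI[of _ 0]) simp
  show "frieze_subring R \<subseteq> R"
  proof (rule frieze_subring_subsetI)
    fix n c assume "nonzero_frieze n R c"
    then show "frieze_entries n c \<subseteq> R"
      using frieze_entries_subset R_of_int[of 0] R_of_int[of 1] by fastforce
  next
    fix x y assume "x \<in> R" "y \<in> R"
    then obtain a b a' b' where xy: "x = of_int a + of_int b * \<omega>" "y = of_int a' + of_int b' * \<omega>"
      unfolding R_def by blast
    have "x + y = of_int (a + a') + of_int (b + b') * \<omega>"
      by (simp add: xy algebra_simps)
    then show "x + y \<in> R" unfolding R_def by blast
    have "x * y = of_int (a * a') + of_int (a * b' + b * a') * \<omega> + of_int (b * b') * \<omega>\<^sup>2"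
      by (simp add: xy algebra_simps power2_eq_square)
    also have "\<dots> = of_int (a * a' - b * b' * Q) + of_int (a * b' + b * a' + b * b' * P) * \<omega>"
      unfolding \<omega> by (simp add: algebra_simps)
    finally show "x * y \<in> R" unfolding R_def by blast
  next
    fix x assume "x \<in> R"
    then obtain a b where "x = of_int a + of_int b * \<omega>" unfolding R_def by blast
    then have "- x = of_int (- a) + of_int (- b) * \<omega>" by simp
    then show "- x \<in> R" unfolding R_def by blast
  qed (use R_of_int[of 1] in simp)
  have "of_int k + of_int 1 * \<omega> \<in> R" unfolding R_def by blast
  then have "of_int k + \<omega> \<in> frieze_subring R"
    using factor_in_frieze_subring[OF e(1)] e(2) R_of_int[of 2] by simp
  then have "of_int (- k) + (of_int k + \<omega>) \<in> frieze_subring R"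
    by (rule frieze_subring_ring_closed(1)[OF of_int_in_frieze_subring])
  moreover have "of_int (- k) + (of_int k + \<omega>) = \<omega>" by simp
  ultimately have "\<omega> \<in> frieze_subring R" by (simp only:)
  then show "R \<subseteq> frieze_subring R"
    unfolding R_def by (auto intro!: frieze_subring_ring_closed of_int_in_frieze_subring)
qed

section \<open>Integral bases and the exceptional discriminants\<close>

lemma int_square_mod_4: "(k::int)\<^sup>2 mod 4 = (if even k then 0 else 1)"
proof (cases "even k")
  case True
  then show ?thesis by (auto elim!: evenE simp: power_mult_distrib)
next
  case False
  then obtain b where "k = 2 * b + 1" by (rule oddE)
  then have "k\<^sup>2 = 4 * (b\<^sup>2 + b) + 1" by (simp add: power2_eq_square algebra_simps)
  then have "k\<^sup>2 mod 4 = 1" by presburger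
  then show ?thesis using False by simp
qed

text \<open>An odd \<open>s\<close> would make \<open>d\<close> a square modulo 4, that is 0 or 1;
  squarefreeness excludes 0 and the hypothesis excludes 1. So \<open>s\<close>, and then
  \<open>t\<close>, is even.\<close>

lemma quadratic_integers_mod_4_ne_1:
  assumes d: "d < 0" "squarefree d" "d mod 4 \<noteq> 1"
  shows "quadratic_integers d = {of_int a + of_int b * csqrt (of_int d) |a b. True}" (is "_ = ?R")
proof
  show "quadratic_integers d \<subseteq> ?R"
  proof
    fix x assume "x \<in> quadratic_integers d"
    then obtain t s where ts: "4 dvd t\<^sup>2 - d * s\<^sup>2" "x = (of_int t + of_int s * csqrt (of_int d)) / 2"
      using quadratic_integers_iff[OF d(1,2)] by blast
    have "even s"
    proof (rule ccontr)
      assume "odd s"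
      then have "d * s\<^sup>2 mod 4 = d mod 4"
        using mod_mult_right_eq[of d "s\<^sup>2" 4] by (simp add: int_square_mod_4)
      moreover have "t\<^sup>2 mod 4 = d * s\<^sup>2 mod 4" using ts(1) by (simp only: mod_eq_dvd_iff)
      ultimately have "t\<^sup>2 mod 4 = d mod 4" by simp
      moreover have "\<not> 4 dvd d"
        using d(2)[unfolded squarefree_def, rule_format, of 2] by auto
      ultimately show False using d(3) by (auto simp: int_square_mod_4 split: if_splits)
    qed
    moreover have "even (t\<^sup>2 - d * s\<^sup>2)" using ts(1) by (rule dvd_trans[rotated]) simp
    with \<open>even s\<close> have "even t" by simp
    ultimately obtain a b where "t = 2 * a" "s = 2 * b" by (auto elim!: evenE)
    then have "x = of_int a + of_int b * csqrt (of_int d)"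
      using ts(2) by (simp add: add_divide_distrib)
    then show "x \<in> ?R" by blast
  qed
  show "?R \<subseteq> quadratic_integers d"
  proof
    fix x assume "x \<in> ?R"
    then obtain a b where "x = of_int a + of_int b * csqrt (of_int d)" by blast
    then show "x \<in> quadratic_integers d"
      unfolding quadratic_integers_iff[OF d(1,2)]
      by - (rule exI[of _ "2 * a"], rule exI[of _ "2 * b"], simp add: power_mult_distrib add_divide_distrib)
  qed
qed

text \<open>As \<open>d\<close> is odd, \<open>t\<close> and \<open>s\<close> have equal parity, so
  t = 2a + s; conversely (2a + b)^2 - d b^2 is a multiple of 4 for all a, b.\<close>

lemma quadratic_integers_mod_4_eq_1:
  assumes d: "d < 0" "squarefree d" "d mod 4 = 1"
  shows "quadratic_integers d = {of_int a + of_int b * ((1 + csqrt (of_int d)) / 2) |a b. True}" (is "_ = ?R")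
proof -
  obtain m where m: "d = 4 * m + 1" using d(3) by (metis mult_div_mod_eq)
  show ?thesis
  proof
    show "quadratic_integers d \<subseteq> ?R"
    proof
      fix x assume "x \<in> quadratic_integers d"
      then obtain t s where ts: "4 dvd t\<^sup>2 - d * s\<^sup>2" "x = (of_int t + of_int s * csqrt (of_int d)) / 2"
        using quadratic_integers_iff[OF d(1,2)] by blast
      have "even (t\<^sup>2 - d * s\<^sup>2)" using ts(1) by (rule dvd_trans[rotated]) simp
      then have "even (t - s)" by (auto simp: m)
      then obtain a where "t = 2 * a + s" by (metis dvdE diff_add_cancel)
      then have "x = of_int a + of_int s * ((1 + csqrt (of_int d)) / 2)"
        using ts(2) by (simp add: field_simps)
      then show "x \<in> ?R" by blast
    qed
    show "?R \<subseteq> quadratic_integers d"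
    proof
      fix x assume "x \<in> ?R"
      then obtain a b where "x = of_int a + of_int b * ((1 + csqrt (of_int d)) / 2)" by blast
      moreover have "4 dvd (2 * a + b)\<^sup>2 - d * b\<^sup>2"
      proof -
        have "(2 * a + b)\<^sup>2 - d * b\<^sup>2 = 4 * (a\<^sup>2 + a * b - m * b\<^sup>2)"
          by (simp add: m power2_eq_square algebra_simps)
        then show ?thesis by simp
      qed
      ultimately show "x \<in> quadratic_integers d"
        unfolding quadratic_integers_iff[OF d(1,2)]
        by - (rule exI[of _ "2 * a + b"], rule exI[of _ b], simp add: field_simps)
    qed
  qed
qed

lemma frieze_subring_quadratic_integers_special:
  assumes d: "d \<in> {-1, -2, -3, -7, -11}" "squarefree d"
  shows "frieze_subring (quadratic_integers d) = quadratic_integers d"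
proof -
  let ?r = "csqrt (of_int d)"
  have r: "?r\<^sup>2 = of_int d" by simp
  have neg: "d < 0" using d by auto
  show ?thesis
  proof (cases "d mod 4 = 1")
    case False
    then have d': "d = - 1 \<or> d = - 2" using d by auto
    \<comment> \<open>The shift \<open>d + 2\<close> is 1 for d = -1 and 0 for d = -2; the product
      with the conjugate is 2 in both cases.\<close>
    have f: "of_int (d + 2) - ?r \<in> {of_int a + of_int b * ?r |a b. True}"
      by (rule CollectI, rule exI[of _ "d + 2"], rule exI[of _ "- 1"]) simp
    have "(of_int (d + 2) + ?r) * (of_int (d + 2) - ?r) = (of_int (d + 2))\<^sup>2 - ?r\<^sup>2"
      by (simp add: power2_eq_square algebra_simps)
    also have "\<dots> = of_int ((d + 2)\<^sup>2 - d)" by simp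
    also have "\<dots> \<in> {2, 3}" using d' by auto
    finally show ?thesis
      unfolding quadratic_integers_mod_4_ne_1[OF neg d(2) False]
      using r f by (intro frieze_subring_monogenic[of _ 0 "- d" "d + 2"]) simp_all
  next
    case True
    then have d': "d \<in> {-3, -7, -11}" using d by auto
    \<comment> \<open>The norm of \<open>k + \<omega>\<close> is k (k + 1) - m with m = (d - 1)/4.
      Without a shift it is 2 for d = -7 and 3 for d = -11; for d = -3 it would be 1, and k = 1
      makes it 3. The cofactor \<open>k + 1 - \<omega>\<close> is the conjugate.\<close>
    define k :: int where "k = (if d = - 3 then 1 else 0)"
    obtain m where m: "d = 4 * m + 1" using True by (metis mult_div_mod_eq)
    define \<omega> where "\<omega> = (1 + ?r) / 2"
    have w: "\<omega>\<^sup>2 = of_int 1 * \<omega> - of_int (- m)"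
      using r unfolding \<omega>_def by (simp add: m power2_eq_square field_simps)
    have f: "of_int (k + 1) - \<omega> \<in> {of_int a + of_int b * \<omega> |a b. True}"
      by (rule CollectI, rule exI[of _ "k + 1"], rule exI[of _ "- 1"]) simp
    have "(of_int k + \<omega>) * (of_int (k + 1) - \<omega>) = of_int (k * (k + 1) - m)"
      using w by (simp add: power2_eq_square algebra_simps)
    also have "\<dots> \<in> {2, 3}"
    proof -
      have "k * (k + 1) - m = 2 \<or> k * (k + 1) - m = 3" using d' m by (auto simp: k_def)
      then show ?thesis by (auto simp only: of_int_numeral insert_iff)
    qed
    finally show ?thesis
      unfolding quadratic_integers_mod_4_eq_1[OF neg d(2) True] \<omega>_def[symmetric]
      using w f by (intro frieze_subring_monogenic[of _ 1 "- m" k]) simp_all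
  qed
qed

theorem theorem5p2:
  fixes d :: int
  assumes "d < 0" and "squarefree d"
  shows "frieze_subring (quadratic_integers d) =
           (if d \<in> {-1, -2, -3, -7, -11} then quadratic_integers d else \<int>)"
proof (cases "d \<in> {-1, -2, -3, -7, -11}")
  case True
  then show ?thesis using frieze_subring_quadratic_integers_special[OF True assms(2)] by simp
next
  case False
  have "frieze_subring (quadratic_integers d) \<subseteq> \<int>"
  proof (rule frieze_subring_subsetI)
    show "frieze_entries n c \<subseteq> \<int>" if "nonzero_frieze n (quadratic_integers d) c" for n c
      using quadratic_integers_norm_less_2[OF assms False]
      by (intro frieze_entries_subset_Ints[OF that]) auto
  qed auto
  moreover have "\<int> \<subseteq> frieze_subring (quadratic_integers d)"
    by (auto elim!: Ints_cases intro: of_int_in_frieze_subring)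
  ultimately show ?thesis unfolding if_not_P[OF False] by (rule subset_antisym)
qed

end
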